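(* For any positive integer $n$ and any $\mathcal{A} \subseteq \mathcal{P}([n])$ with $|\mathcal{A}| \leq 2^{n-1}$, we have $$f(\mathcal{A}) \leq 2F(|\mathcal{A}|),$$ where $f(\mathcal{A}) := 2e(\mathcal{A}) + |\mathcal{A} \cap \overline{\mathcal{A}}|$.
   Context: For a positive integer $n$, $[n] := \{1,2,\ldots,n\}$ and $\mathcal{P}([n])$ is its power set. $Q_n$ is the discrete cube graph: its vertex set is $\mathcal{P}([n])$, and $x,y$ are joined by an edge iff $|x \Delta y| = 1$. For $\mathcal{A} \subseteq \mathcal{P}([n])$, $e(\mathcal{A})$ is the number of edges of $Q_n$ with both end-vertices in $\mathcal{A}$. For $x \subseteq [n]$, $\overline{x} := [n] \setminus x$, and $\overline{\mathcal{A}} := \{\overline{x} : x \in \mathcal{A}\}$. The binary ordering on $\mathcal{P}([n])$ is defined by $x < y$ iff $x \neq y$ and $\max(x \Delta y) \in y$. For an integer $0 \le k \leq 2^n$, $\mathcal{I}_{n,k}$ denotes the set of the $k$ smallest elements of $\mathcal{P}([n])$ in the binary ordering, and $F(k) := e(\mathcal{I}_{n,k})$; this value is independent of the choice of $n$ with $2^n \geq k$ (and $F(0)=0$). *)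

theory Defs
  imports Main
begin

definition cube_edges :: "nat \<Rightarrow> nat set set set" where
  "cube_edges n = {{x, y} | x y. x \<in> Pow {1..n} \<and> y \<in> Pow {1..n} \<and> card (sym_diff x y) = 1}"

definition induced_edges :: "nat \<Rightarrow> nat set set \<Rightarrow> nat" where
  "induced_edges n A = card {E \<in> cube_edges n. E \<subseteq> A}"

definition compl_family :: "nat \<Rightarrow> nat set set \<Rightarrow> nat set set" where
  "compl_family n A = (\<lambda>x. {1..n} - x) ` A"

definition binary_less :: "nat set \<Rightarrow> nat set \<Rightarrow> bool" where
  "binary_less x y \<longleftrightarrow> x \<noteq> y \<and> Max (sym_diff x y) \<in> y"

text \<open>The \<open>k\<close> smallest elements are those with fewer than \<open>k\<close> predecessors.\<close>

definition initial_segment :: "nat \<Rightarrow> nat \<Rightarrow> nat set set" where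
  "initial_segment n k = {x \<in> Pow {1..n}. card {y \<in> Pow {1..n}. binary_less y x} < k}"

text \<open>The value does not depend on the choice of the dimension; this is
  \<open>F_eq_induced_edges\<close> below.\<close>

definition F :: "nat \<Rightarrow> nat" where
  "F k = (let n = (LEAST n. k \<le> 2 ^ n) in induced_edges n (initial_segment n k))"

definition f :: "nat \<Rightarrow> nat set set \<Rightarrow> nat" where
  "f n A = 2 * induced_edges n A + card (A \<inter> compl_family n A)"

lemma binary_less_Pow:
  assumes "binary_less y x" "x \<subseteq> {1..n}" "y \<subseteq> {1..m}"
  shows "y \<subseteq> {1..n}"
proof
  fix i assume i: "i \<in> y"
  have fin: "finite (sym_diff y x)"
    using assms(2,3) by (meson finite_Diff finite_UnI finite_atLeastAtMost finite_subset)
  show "i \<in> {1..n}"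
  proof (cases "i \<in> x")
    case False
    then have "i \<le> Max (sym_diff y x)" using fin i by (intro Max_ge) auto
    moreover have "Max (sym_diff y x) \<le> n" using assms(1,2) by (auto simp: binary_less_def)
    moreover have "1 \<le> i" using i assms(3) by auto
    ultimately show ?thesis by auto
  qed (use assms(2) in auto)
qed

lemma binary_less_total:
  assumes "finite x" "finite y" "x \<noteq> y"
  shows "binary_less x y \<or> binary_less y x"
proof -
  have "Max (sym_diff x y) \<in> sym_diff x y" using assms by (intro Max_in) auto
  moreover have "sym_diff y x = sym_diff x y" by auto
  ultimately show ?thesis using assms(3) by (auto simp: binary_less_def)
qed

lemma binary_less_iff:
  assumes "finite x" "finite y"
  shows "binary_less x y \<longleftrightarrow> (\<exists>m. m \<in> y \<and> m \<notin> x \<and> (\<forall>i>m. i \<in> x \<longleftrightarrow> i \<in> y))"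
proof
  assume l: "binary_less x y"
  define m where "m = Max (sym_diff x y)"
  have "m \<in> y" using l by (simp add: binary_less_def m_def)
  have "m \<in> sym_diff x y"
    unfolding m_def using assms l by (intro Max_in) (auto simp: binary_less_def)
  then have "m \<notin> x" using \<open>m \<in> y\<close> by blast
  have le: "i \<le> m" if "i \<in> sym_diff x y" for i
    unfolding m_def using that assms by (intro Max_ge) auto
  have "\<forall>i>m. i \<in> x \<longleftrightarrow> i \<in> y"
  proof (intro allI impI)
    fix i assume "m < i"
    then have "i \<notin> sym_diff x y" using le[of i] by linarith
    then show "i \<in> x \<longleftrightarrow> i \<in> y" by blast
  qed
  then show "\<exists>m. m \<in> y \<and> m \<notin> x \<and> (\<forall>i>m. i \<in> x \<longleftrightarrow> i \<in> y)"
    using \<open>m \<in> y\<close> \<open>m \<notin> x\<close> by blast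
next
  assume "\<exists>m. m \<in> y \<and> m \<notin> x \<and> (\<forall>i>m. i \<in> x \<longleftrightarrow> i \<in> y)"
  then obtain m where m: "m \<in> y" "m \<notin> x" "\<forall>i>m. i \<in> x \<longleftrightarrow> i \<in> y" by blast
  have le: "i \<le> m" if "i \<in> sym_diff x y" for i
    using that m(3) by (metis Diff_iff Un_iff not_less)
  have "Max (sym_diff x y) = m"
    by (rule Max_eqI) (use assms m le in auto)
  then show "binary_less x y" using m by (auto simp: binary_less_def)
qed

lemma binary_less_trans:
  assumes "binary_less x y" "binary_less y z" "finite x" "finite y" "finite z"
  shows "binary_less x z"
proof -
  obtain a where a: "a \<in> y" "a \<notin> x" "\<forall>i>a. i \<in> x \<longleftrightarrow> i \<in> y"
    using assms(1) binary_less_iff[OF assms(3,4)] by auto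
  obtain b where b: "b \<in> z" "b \<notin> y" "\<forall>i>b. i \<in> y \<longleftrightarrow> i \<in> z"
    using assms(2) binary_less_iff[OF assms(4,5)] by auto
  have "max a b \<in> z \<and> max a b \<notin> x \<and> (\<forall>i>max a b. i \<in> x \<longleftrightarrow> i \<in> z)"
  proof (cases "a < b")
    case True
    then show ?thesis using a b by (metis less_trans max.absorb4)
  next
    case False
    moreover have "a \<noteq> b" using a b by blast
    ultimately have "b < a" by simp
    then show ?thesis using a b by (metis less_trans max.absorb3)
  qed
  then show ?thesis using binary_less_iff[OF assms(3,5)] by blast
qed

lemma card_initial_segment:
  assumes "k \<le> 2 ^ n"
  shows "card (initial_segment n k) = k"
proof -
  define P where "P = Pow {1..n}"
  define r where "r x = card {y \<in> P. binary_less y x}" for x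
  have finE: "finite x" if "x \<in> P" for x
    using that finite_subset unfolding P_def by auto
  have finP: "finite P" by (simp add: P_def)
  have cP: "card P = 2 ^ n" by (simp add: P_def card_Pow)
  have mono: "r x < r y" if "binary_less x y" "x \<in> P" "y \<in> P" for x y
    unfolding r_def
  proof (rule psubset_card_mono)
    show "finite {z \<in> P. binary_less z y}" using finP by simp
    have "\<not> binary_less x x" by (simp add: binary_less_def)
    then show "{z \<in> P. binary_less z x} \<subset> {z \<in> P. binary_less z y}"
      using that binary_less_trans finE by blast
  qed
  have inj: "inj_on r P"
  proof (rule inj_onI, rule ccontr)
    fix x y assume "x \<in> P" "y \<in> P" "r x = r y" "x \<noteq> y"
    then show False using binary_less_total[of x y] mono[of x y] mono[of y x] finE by auto
  qed
  have "r x < 2 ^ n" if "x \<in> P" for x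
  proof -
    have "{y \<in> P. binary_less y x} \<subset> P" using that by (auto simp: binary_less_def)
    then show ?thesis unfolding r_def cP[symmetric] using finP by (rule psubset_card_mono[rotated])
  qed
  then have rP: "r ` P = {..<2 ^ n}"
    using inj cP by (intro card_subset_eq) (auto simp: card_image)
  have "r ` {x \<in> P. r x < k} = {..<k}"
  proof
    show "{..<k} \<subseteq> r ` {x \<in> P. r x < k}"
    proof
      fix j assume j: "j \<in> {..<k}"
      then have "j \<in> r ` P" unfolding rP using assms by simp
      then show "j \<in> r ` {x \<in> P. r x < k}" using j by blast
    qed
  qed auto
  moreover have "inj_on r {x \<in> P. r x < k}" using inj by (rule inj_on_subset) auto
  ultimately have "card {x \<in> P. r x < k} = k" by (metis card_image card_lessThan)
  then show ?thesis by (simp add: initial_segment_def r_def P_def)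
qed

lemma initial_segment_mono_dim:
  assumes "n \<le> m" "k \<le> 2 ^ n"
  shows "initial_segment m k = initial_segment n k"
proof -
  have nm: "Pow {1..n} \<subseteq> Pow {1..m}" using assms(1) by auto
  have eq: "{y \<in> Pow {1..m}. binary_less y x} = {y \<in> Pow {1..n}. binary_less y x}"
    if "x \<in> Pow {1..n}" for x
  proof -
    have "y \<in> Pow {1..n}" if "y \<in> Pow {1..m}" "binary_less y x" for y
      using binary_less_Pow[OF that(2), of n m] that(1) \<open>x \<in> Pow {1..n}\<close> by simp
    then show ?thesis using nm by blast
  qed
  have sub: "initial_segment n k \<subseteq> initial_segment m k"
  proof
    fix x assume "x \<in> initial_segment n k"
    then have x: "x \<in> Pow {1..n}" "card {y \<in> Pow {1..n}. binary_less y x} < k"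
      by (simp_all add: initial_segment_def)
    then have "card {y \<in> Pow {1..m}. binary_less y x} < k" by (simp only: eq[OF x(1)])
    moreover have "x \<in> Pow {1..m}" using x(1) nm by blast
    ultimately show "x \<in> initial_segment m k" by (simp add: initial_segment_def)
  qed
  have "(2::nat) ^ n \<le> 2 ^ m" using assms(1) by (intro power_increasing) auto
  then have "k \<le> 2 ^ m" using assms(2) by linarith
  moreover have "finite (initial_segment m k)" by (simp add: initial_segment_def)
  ultimately show ?thesis
    using sub card_initial_segment assms(2) by (metis card_subset_eq)
qed

lemma induced_edges_mono_dim:
  assumes "n \<le> m" "A \<subseteq> Pow {1..n}"
  shows "induced_edges m A = induced_edges n A"
proof -
  have nm: "Pow {1..n} \<subseteq> Pow {1..m}" using assms(1) by auto
  have "E \<in> cube_edges m \<longleftrightarrow> E \<in> cube_edges n" if E: "E \<subseteq> A" for E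
  proof
    assume "E \<in> cube_edges m"
    then obtain x y where xy: "E = {x, y}" "card (sym_diff x y) = 1"
      unfolding cube_edges_def by blast
    then have "x \<in> Pow {1..n}" "y \<in> Pow {1..n}" using E assms(2) by auto
    then show "E \<in> cube_edges n" unfolding cube_edges_def using xy by blast
  next
    assume "E \<in> cube_edges n"
    then obtain x y where xy: "E = {x, y}" "card (sym_diff x y) = 1"
        "x \<in> Pow {1..n}" "y \<in> Pow {1..n}"
      unfolding cube_edges_def by blast
    then have "x \<in> Pow {1..m}" "y \<in> Pow {1..m}" using nm by auto
    then show "E \<in> cube_edges m" unfolding cube_edges_def using xy by blast
  qed
  then have "{E \<in> cube_edges m. E \<subseteq> A} = {E \<in> cube_edges n. E \<subseteq> A}" by blast
  then show ?thesis by (simp add: induced_edges_def)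
qed

lemma F_eq_induced_edges:
  assumes "k \<le> 2 ^ n"
  shows "F k = induced_edges n (initial_segment n k)"
proof -
  define l where "l = (LEAST n. k \<le> (2::nat) ^ n)"
  have l: "k \<le> 2 ^ l" "l \<le> n"
    unfolding l_def using assms by (auto intro: LeastI Least_le)
  have "initial_segment l k \<subseteq> Pow {1..l}" by (auto simp: initial_segment_def)
  then show ?thesis
    using l initial_segment_mono_dim[of l n k] induced_edges_mono_dim[of l n]
    by (simp add: F_def Let_def l_def)
qed

end

theory Submission
  imports Defs
begin

text \<open>Split a family by its top coordinate into halves \<open>B\<close> and \<open>C\<close>. Both the edges and the antipodal
  pairs joining the halves become incidences between \<open>B\<close> and \<open>C\<close> or its antipode, so induction on the
  dimension applies to the bound \<open>f n A \<le> 2 F(|A|) + max 0 (2 |A| - 2\<^sup>n)\<close>, which makes sense without the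
  restriction on \<open>|A|\<close>. What remains is an inequality for \<open>F\<close>, which follows from superadditivity
  \<open>F(a) + F(b) + min a b \<le> F(a + b)\<close>, the doubling formula \<open>F(2\<^sup>m + r) = F(2\<^sup>m) + F(r) + r\<close> and the
  complement formula \<open>F(2\<^sup>m - c) + m c = F(2\<^sup>m) + F(c)\<close>. These are proved for the solution of the
  parity recursion \<open>F(n) = F(n div 2) + F((n + 1) div 2) + n div 2\<close>.\<close>

section \<open>Arithmetic of the parity recursion and the numerical induction step\<close>

text \<open>The value at \<open>n\<close> is the total number of ones in the binary expansions of 0,
  ..., n - 1. Splitting these numbers by their last digit gives the recursion.\<close>

fun binary_edge_count :: "nat \<Rightarrow> nat" where
  "binary_edge_count n =
    (if n \<le> 1 then 0
     else binary_edge_count (n div 2) + binary_edge_count ((n + 1) div 2) + n div 2)"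

declare binary_edge_count.simps [simp del]

lemma binary_edge_count_0 [simp]: "binary_edge_count 0 = 0"
  and binary_edge_count_1 [simp]: "binary_edge_count (Suc 0) = 0"
  by (simp_all add: binary_edge_count.simps)

lemma binary_edge_count_double: "binary_edge_count (2 * n) = 2 * binary_edge_count n + n"
  by (cases "n = 0") (simp_all add: binary_edge_count.simps[of "2 * n"])

lemma binary_edge_count_odd:
  "binary_edge_count (2 * n + 1) = binary_edge_count n + binary_edge_count (n + 1) + n"
  by (cases "n = 0") (simp_all add: binary_edge_count.simps[of "Suc (2 * n)"])

text \<open>Both arguments are halved, with floors and ceilings matched so that the two half-sums
  are the halves of \<open>a + b\<close>. The minimum splits accordingly, and the
  \<open>n div 2\<close> terms cancel up to the carry when both are odd.\<close>

lemma binary_edge_count_superadd: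
  "binary_edge_count a + binary_edge_count b + min a b \<le> binary_edge_count (a + b)"
proof (induction "a + b" arbitrary: a b rule: less_induct)
  case less
  let ?E = binary_edge_count
  \<comment> \<open>The induction hypothesis is restated as a premise so that the even-odd case can
    reuse this with the roles exchanged. If \<open>p + q = 0\<close>, the larger half-sum would be
    \<open>a + b\<close> itself.\<close>
  have mixed: "?E a + ?E b + min a b \<le> ?E (a + b)"
    if a: "a = 2 * p + 1" and b: "b = 2 * q"
      and IH: "\<And>x y. x + y < a + b \<Longrightarrow> ?E x + ?E y + min x y \<le> ?E (x + y)" for a b p q
  proof (cases "p + q = 0")
    case False
    have "?E p + ?E q + min p q \<le> ?E (p + q)"
      by (rule IH) (use a b in simp)
    moreover have "?E (p + 1) + ?E q + min (p + 1) q \<le> ?E (p + 1 + q)"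
      by (rule IH) (use a b False in auto)
    moreover have "?E (a + b) = ?E (p + q) + ?E (p + 1 + q) + (p + q)"
      using binary_edge_count_odd[of "p + q"] a b by (simp add: algebra_simps)
    moreover have "?E a = ?E p + ?E (p + 1) + p"
      unfolding a by (rule binary_edge_count_odd)
    moreover have "?E b = 2 * ?E q + q"
      unfolding b by (rule binary_edge_count_double)
    moreover have "min a b \<le> min p q + min (p + 1) q" using a b by auto
    ultimately show ?thesis by linarith
  qed (use a b in simp)
  consider (ee) p q where "a = 2 * p" "b = 2 * q" | (oe) p q where "a = 2 * p + 1" "b = 2 * q"
    | (eo) p q where "a = 2 * p" "b = 2 * q + 1" | (oo) p q where "a = 2 * p + 1" "b = 2 * q + 1"
    by (meson evenE oddE)
  then show ?case
  proof cases
    case ee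
    show ?thesis
    proof (cases "p + q = 0")
      case False
      have "?E p + ?E q + min p q \<le> ?E (p + q)"
        by (rule less) (use ee False in auto)
      moreover have "?E (a + b) = 2 * ?E (p + q) + (p + q)"
        using binary_edge_count_double[of "p + q"] ee by (simp add: algebra_simps)
      ultimately show ?thesis using ee by (auto simp: binary_edge_count_double)
    qed (use ee in simp)
  next
    case oe
    show ?thesis by (rule mixed[OF oe less])
  next
    case eo
    have "?E b + ?E a + min b a \<le> ?E (b + a)"
    proof (rule mixed[OF eo(2,1)])
      show "?E x + ?E y + min x y \<le> ?E (x + y)" if "x + y < b + a" for x y
        by (rule less) (use that in simp)
    qed
    then show ?thesis by (simp add: ac_simps)
  next
    case oo
    \<comment> \<open>With both arguments odd, each floor meets the other's ceiling, so both
      half-sums equal \<open>p + q + 1\<close>.\<close>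
    have "?E p + ?E (q + 1) + min p (q + 1) \<le> ?E (p + (q + 1))"
      by (rule less) (use oo in simp)
    moreover have "?E (p + 1) + ?E q + min (p + 1) q \<le> ?E (p + 1 + q)"
      by (rule less) (use oo in simp)
    moreover have "?E (a + b) = 2 * ?E (p + q + 1) + (p + q + 1)"
      using binary_edge_count_double[of "p + q + 1"] oo by (simp add: algebra_simps)
    moreover have "?E a = ?E p + ?E (p + 1) + p"
      unfolding oo by (rule binary_edge_count_odd)
    moreover have "?E b = ?E q + ?E (q + 1) + q"
      unfolding oo by (rule binary_edge_count_odd)
    moreover have "min a b \<le> min p (q + 1) + min (p + 1) q + 1" using oo by auto
    ultimately show ?thesis by (simp add: ac_simps)
  qed
qed

text \<open>In terms of digit sums, each of the \<open>r\<close> numbers from \<open>2 ^ m\<close>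
  on has one more one, the leading digit, than the number obtained by subtracting
  \<open>2 ^ m\<close>.\<close>

lemma binary_edge_count_pow2_add:
  assumes "r \<le> 2 ^ m"
  shows "binary_edge_count (2 ^ m + r) = binary_edge_count (2 ^ m) + binary_edge_count r + r"
  using assms
proof (induction m arbitrary: r)
  case 0
  then consider "r = 0" | "r = 1" by force
  then show ?case by cases (use binary_edge_count_double[of 1] in \<open>simp_all add: numeral_2_eq_2\<close>)
next
  case (Suc m)
  show ?case
  proof (cases "even r")
    case True
    then obtain s where s: "r = 2 * s" by (elim evenE)
    then show ?thesis
      using Suc.IH[of s] Suc.prems binary_edge_count_double[of "2 ^ m + s"]
      by (simp add: binary_edge_count_double)
  next
    case False
    then obtain s where s: "r = 2 * s + 1" by (elim oddE)
    \<comment> \<open>An odd \<open>r\<close> needs the induction hypothesis at \<open>s\<close> and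
      at \<open>s + 1\<close>; strictness here keeps \<open>s + 1\<close> in range.\<close>
    have "s < 2 ^ m" using s Suc.prems by simp
    then show ?thesis
      using Suc.IH[of s] Suc.IH[of "s + 1"] binary_edge_count_odd[of "2 ^ m + s"]
        binary_edge_count_odd[of s] s
      by (simp add: binary_edge_count_double)
  qed
qed

text \<open>Exchanging zeros and ones maps the last \<open>c\<close> of the \<open>m\<close>-digit
  numbers to the first \<open>c\<close>, and the two digit sums add up to \<open>m\<close>. Stating
  it with \<open>c + d\<close> avoids truncated subtraction.\<close>

lemma binary_edge_count_pow2_compl:
  assumes "c + d = 2 ^ m"
  shows "binary_edge_count d + m * c = binary_edge_count (2 ^ m) + binary_edge_count c"
  using assms
proof (induction m arbitrary: c d)
  case 0
  then consider "c = 0 \<and> d = 1" | "c = 1 \<and> d = 0" by force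
  then show ?case by cases simp_all
next
  case (Suc m)
  show ?case
  proof (cases "even c")
    case True
    then have "even d" using Suc.prems by (metis even_add even_power even_numeral zero_less_Suc)
    then obtain s t where s: "c = 2 * s" "d = 2 * t" using True by (auto elim!: evenE)
    then show ?thesis
      using Suc.IH[of s t] Suc.prems binary_edge_count_double[of s] binary_edge_count_double[of t]
        binary_edge_count_double[of "2 ^ m"]
      by (simp add: algebra_simps)
  next
    case False
    then have "odd d" using Suc.prems by (metis even_add even_power even_numeral zero_less_Suc)
    then obtain s t where s: "c = 2 * s + 1" "d = 2 * t + 1" using False by (auto elim!: oddE)
    then show ?thesis
      using Suc.IH[of s "t + 1"] Suc.IH[of "s + 1" t] Suc.prems
        binary_edge_count_odd[of s] binary_edge_count_odd[of t] binary_edge_count_double[of "2 ^ m"]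
      by (simp add: algebra_simps)
  qed
qed

text \<open>This is superadditivity for the complements of \<open>r\<close> and \<open>b\<close> in
  \<open>2 ^ m\<close>. Their sum is the complement of \<open>t\<close>, so the terms with factor
  \<open>m\<close> cancel.\<close>

lemma binary_edge_count_pow2_swap:
  assumes "r \<le> 2 ^ m" "b \<le> 2 ^ m" "r + b = 2 ^ m + t"
  shows "binary_edge_count r + binary_edge_count b + min (2 ^ m - r) (2 ^ m - b)
    \<le> binary_edge_count (2 ^ m) + binary_edge_count t"
proof -
  let ?E = binary_edge_count
  define u v where "u = 2 ^ m - r" and "v = 2 ^ m - b"
  have "u + r = 2 ^ m" "v + b = 2 ^ m" "(u + v) + t = 2 ^ m"
    using assms by (simp_all add: u_def v_def)
  then have "?E r + m * u = ?E (2 ^ m) + ?E u" "?E b + m * v = ?E (2 ^ m) + ?E v"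
      "?E t + m * (u + v) = ?E (2 ^ m) + ?E (u + v)"
    by (intro binary_edge_count_pow2_compl; simp)+
  then show ?thesis
    using binary_edge_count_superadd[of u v] unfolding u_def[symmetric] v_def[symmetric]
    by (simp add: algebra_simps)
qed

text \<open>\<open>T\<close> stands for \<open>f\<close> of a family split by its top coordinate into halves of sizes \<open>a\<close> and \<open>b\<close>.
  The first bound comes from edge isoperimetry inside the halves and counting all crossing pairs, the
  second from the induction hypothesis. Neither suffices alone.\<close>

lemma folded_cube_recurrence_le:
  assumes "b \<le> a" "a \<le> 2 ^ m"
    and trivial: "T \<le> 2 * binary_edge_count a + 2 * binary_edge_count b + 4 * b"
    and antipodal: "T \<le> (2 * binary_edge_count a + (2 * a - 2 ^ m))
      + (2 * binary_edge_count b + (2 * b - 2 ^ m)) + 2 * b"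
  shows "T \<le> 2 * binary_edge_count (a + b) + (2 * (a + b) - 2 ^ Suc m)"
proof -
  let ?E = binary_edge_count
  have super: "?E a + ?E b + b \<le> ?E (a + b)"
    using binary_edge_count_superadd[of a b] \<open>b \<le> a\<close> by (simp add: min_absorb2)
  \<comment> \<open>If \<open>a\<close> and \<open>b\<close> lie on the same side of half the cube,
    their excesses add up to the total excess and superadditivity suffices. Otherwise only
    \<open>a\<close> is above half; \<open>point\<close> is the dimension in which
    \<open>2 ^ m\<close> cannot be halved.\<close>
  consider (same_side) "2 * a \<le> 2 ^ m \<or> 2 ^ m < 2 * b"
    | (point) "m = 0" "2 ^ m < 2 * a" "2 * b \<le> 2 ^ m"
    | (across) k where "m = Suc k" "2 ^ m < 2 * a" "2 * b \<le> 2 ^ m"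
    by (metis not0_implies_Suc not_less)
  then show ?thesis
  proof cases
    case same_side
    have "(2 * a - N) + (2 * b - N) \<le> 2 * (a + b) - 2 * N"
      if "2 * a \<le> N \<or> N < 2 * b" for N :: nat
      using that \<open>b \<le> a\<close> by auto
    from this[OF same_side] show ?thesis using super antipodal by simp
  next
    case point
    then have "a = 1" "b = 0" using \<open>a \<le> 2 ^ m\<close> by simp_all
    then show ?thesis using trivial by simp
  next
    case across
    define h :: nat where "h = 2 ^ k"
    have N: "2 ^ m = 2 * h" by (simp add: h_def across(1))
    have "h \<le> a" "b \<le> h" using across(2,3) unfolding N by simp_all
    then obtain r where r: "a = h + r" by (auto simp: le_iff_add)
    have "r \<le> h" using \<open>a \<le> 2 ^ m\<close> unfolding r N by simp
    have Ea: "?E a = ?E h + ?E r + r"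
      using binary_edge_count_pow2_add[of r k] \<open>r \<le> h\<close> unfolding r h_def by simp
    have T1: "T \<le> 2 * ?E h + 2 * ?E r + 2 * r + 2 * ?E b + 4 * b"
      using trivial unfolding Ea by simp
    have T2: "T \<le> 2 * ?E h + 2 * ?E r + 4 * r + 2 * ?E b + 2 * b"
      using antipodal \<open>b \<le> h\<close> unfolding Ea unfolding N r by simp
    show ?thesis
    proof (cases "r + b \<le> h")
      case True
      have "?E (a + b) = ?E h + ?E (r + b) + (r + b)"
        using binary_edge_count_pow2_add[of "r + b" k] True unfolding r h_def
        by (simp only: add.assoc)
      \<comment> \<open>\<open>T2\<close> fits when \<open>r\<close> is the minimum, and
        \<open>T1\<close> when \<open>b\<close> is.\<close>
      moreover have "?E r + ?E b + r \<le> ?E (r + b) \<or> ?E r + ?E b + b \<le> ?E (r + b)"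
        using binary_edge_count_superadd[of r b] by (metis min_def)
      ultimately have "T \<le> 2 * ?E (a + b)" using T1 T2 by (elim disjE) simp_all
      then show ?thesis by (rule trans_le_add1)
    next
      case False
      then obtain t where t: "r + b = h + t" by (metis le_iff_add nat_le_linear)
      have ab: "a + b = 2 * h + t" "t \<le> 2 * h"
        using t r \<open>r \<le> h\<close> \<open>b \<le> h\<close> by linarith+
      have "?E (a + b) = 2 * ?E h + h + ?E t + t"
        using binary_edge_count_pow2_add[of t m] ab(2) unfolding ab(1) N
        by (simp only: binary_edge_count_double)
      moreover have "2 * (a + b) - 2 ^ Suc m = 2 * t"
        unfolding ab(1) power_Suc N by simp
      moreover have "T \<le> 4 * ?E h + 2 * h + 2 * ?E t + 4 * t"
      proof -
        \<comment> \<open>The overflow \<open>t\<close> is what the excess term pays for. With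
          complements in \<open>h\<close>, \<open>T1\<close> closes the case where \<open>u\<close>
          is the minimum and \<open>T2\<close> the one where \<open>v\<close> is.\<close>
        define u v where "u = h - r" and "v = h - b"
        have b: "b = u + t" and r: "r = v + t" and h: "h = u + v + t"
          using t \<open>r \<le> h\<close> \<open>b \<le> h\<close> by (simp_all add: u_def v_def)
        have "?E r + ?E b + min u v \<le> ?E h + ?E t"
          using \<open>r \<le> h\<close> \<open>b \<le> h\<close> t unfolding h_def u_def v_def
          by (rule binary_edge_count_pow2_swap)
        then consider "?E r + ?E b + u \<le> ?E h + ?E t" | "?E r + ?E b + v \<le> ?E h + ?E t"
          by (metis min_def)
        then show ?thesis
        proof cases
          case 1
          then show ?thesis using T1 b h r by linarith
        next
          case 2
          then show ?thesis using T2 b h r by linarith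
        qed
      qed
      ultimately show ?thesis by simp
    qed
  qed
qed

lemma folded_cube_recurrence:
  assumes "a \<le> 2 ^ m" "b \<le> 2 ^ m"
    and "T \<le> 2 * binary_edge_count a + 2 * binary_edge_count b + 4 * min a b"
    and "T \<le> (2 * binary_edge_count a + (2 * a - 2 ^ m))
      + (2 * binary_edge_count b + (2 * b - 2 ^ m)) + 2 * min a b"
  shows "T \<le> 2 * binary_edge_count (a + b) + (2 * (a + b) - 2 ^ Suc m)"
proof (cases "b \<le> a")
  case True
  then show ?thesis
    using assms(1,3,4) unfolding min_absorb2[OF True] by (rule folded_cube_recurrence_le)
next
  case False
  then have "a \<le> b" by simp
  then have "T \<le> 2 * binary_edge_count (b + a) + (2 * (b + a) - 2 ^ Suc m)"
  proof (rule folded_cube_recurrence_le[OF _ assms(2)])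
    show "T \<le> 2 * binary_edge_count b + 2 * binary_edge_count a + 4 * a"
      using assms(3) unfolding min_absorb1[OF \<open>a \<le> b\<close>] by simp
    show "T \<le> (2 * binary_edge_count b + (2 * b - 2 ^ m))
        + (2 * binary_edge_count a + (2 * a - 2 ^ m)) + 2 * a"
      using assms(4) unfolding min_absorb1[OF \<open>a \<le> b\<close>] by simp
  qed
  then show ?thesis by (simp only: add.commute)
qed

section \<open>Splitting by the top coordinate and edge isoperimetry\<close>

lemma finite_subfamily: "A \<subseteq> Pow {1..n} \<Longrightarrow> finite A" for n :: nat
  by (rule finite_subset) auto

lemma Suc_notin_Pow: "x \<in> Pow {1..n} \<Longrightarrow> Suc n \<notin> x"
  by auto

lemma inj_on_insert_Suc: "inj_on (insert (Suc n)) (Pow {1..n})"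
  by (rule inj_onI) (metis Suc_notin_Pow insert_ident)

lemma split_family:
  assumes "A \<subseteq> Pow {1..Suc n}"
  obtains B C where "B \<subseteq> Pow {1..n}" "C \<subseteq> Pow {1..n}" "A = B \<union> insert (Suc n) ` C"
proof
  let ?B = "{x \<in> Pow {1..n}. x \<in> A}" and ?C = "{x \<in> Pow {1..n}. insert (Suc n) x \<in> A}"
  show "?B \<subseteq> Pow {1..n}" "?C \<subseteq> Pow {1..n}" by auto
  show "A = ?B \<union> insert (Suc n) ` ?C"
  proof
    show "A \<subseteq> ?B \<union> insert (Suc n) ` ?C"
    proof
      fix x assume x: "x \<in> A"
      then have sub: "x \<subseteq> insert (Suc n) {1..n}" using assms by (auto simp: atLeastAtMostSuc_conv)
      show "x \<in> ?B \<union> insert (Suc n) ` ?C"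
      proof (cases "Suc n \<in> x")
        case True
        then have "x = insert (Suc n) (x - {Suc n})" by auto
        moreover have "x - {Suc n} \<in> ?C"
          using sub x True by (auto simp: insert_absorb)
        ultimately show ?thesis by blast
      next
        case False
        then show ?thesis using sub x by blast
      qed
    qed
  qed auto
qed

lemma card_split_family:
  assumes "B \<subseteq> Pow {1..n}" "C \<subseteq> Pow {1..n}"
  shows "card (B \<union> insert (Suc n) ` C) = card B + card C"
proof -
  have "B \<inter> insert (Suc n) ` C = {}" using assms(1) Suc_notin_Pow by blast
  then show ?thesis
    using assms finite_subfamily card_image[OF inj_on_subset[OF inj_on_insert_Suc assms(2)]]
    by (simp add: card_Un_disjoint)
qed

lemma cube_edgesI:
  "x \<in> Pow {1..n} \<Longrightarrow> y \<in> Pow {1..n} \<Longrightarrow> card (sym_diff x y) = 1 \<Longrightarrow> {x, y} \<in> cube_edges n"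
  unfolding cube_edges_def by blast

lemma cube_edgesE:
  assumes "E \<in> cube_edges n"
  obtains x y where "E = {x, y}" "x \<in> Pow {1..n}" "y \<in> Pow {1..n}" "card (sym_diff x y) = 1"
  using assms unfolding cube_edges_def by blast

text \<open>An edge either keeps the coordinate \<open>Suc n\<close>, lying in one of the halves
  (\<open>S0\<close>, or the image of \<open>S1\<close>), or flips it (\<open>S2\<close>). A
  flipping edge is determined by its lower end, which lies in \<open>B \<inter> C\<close>.\<close>

lemma induced_edges_split:
  assumes "B \<subseteq> Pow {1..n}" "C \<subseteq> Pow {1..n}"
  shows "induced_edges (Suc n) (B \<union> insert (Suc n) ` C)
    = induced_edges n B + induced_edges n C + card (B \<inter> C)"
proof -
  let ?i = "insert (Suc n)"
  let ?P = "Pow {1..n}"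
  define S0 where "S0 = {E \<in> cube_edges n. E \<subseteq> B}"
  define S1 where "S1 = {E \<in> cube_edges n. E \<subseteq> C}"
  define S2 where "S2 = (\<lambda>x. {x, ?i x}) ` (B \<inter> C)"
  have BP: "x \<in> ?P" if "x \<in> B" for x using that assms by blast
  have CP: "x \<in> ?P" if "x \<in> C" for x using that assms by blast
  have ni: "Suc n \<notin> x" if "x \<in> ?P" for x using that by (rule Suc_notin_Pow)
  have PS: "x \<in> Pow {1..Suc n}" "?i x \<in> Pow {1..Suc n}" if "x \<in> ?P" for x using that by auto
  have d1: "sym_diff (?i x) (?i y) = sym_diff x y" if "x \<in> ?P" "y \<in> ?P" for x y
    using ni[OF that(1)] ni[OF that(2)] by auto
  have d2: "x = y" if xy: "x \<in> ?P" "y \<in> ?P" "card (sym_diff x (?i y)) = 1" for x y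
  proof -
    obtain z where z: "sym_diff x (?i y) = {z}" using xy(3) by (metis card_1_singletonE)
    moreover have "Suc n \<in> sym_diff x (?i y)" using ni[OF xy(1)] by auto
    ultimately have "sym_diff x (?i y) = {Suc n}" by auto
    then show ?thesis using ni[OF xy(1)] ni[OF xy(2)] by blast
  qed
  have d3: "card (sym_diff x (?i x)) = 1" if "x \<in> ?P" for x
  proof -
    have "sym_diff x (?i x) = {Suc n}" using ni[OF that] by auto
    then show ?thesis by simp
  qed
  have sd: "sym_diff x y = sym_diff y x" for x y :: "nat set" by auto
  have eq: "{E \<in> cube_edges (Suc n). E \<subseteq> B \<union> ?i ` C} = S0 \<union> (`) ?i ` S1 \<union> S2"
  proof
    show "{E \<in> cube_edges (Suc n). E \<subseteq> B \<union> ?i ` C} \<subseteq> S0 \<union> (`) ?i ` S1 \<union> S2"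
    proof
      fix E assume "E \<in> {E \<in> cube_edges (Suc n). E \<subseteq> B \<union> ?i ` C}"
      then have "E \<in> cube_edges (Suc n)" and EBC: "E \<subseteq> B \<union> ?i ` C" by simp_all
      then obtain x y where E: "E = {x, y}" "card (sym_diff x y) = 1"
        by (elim cube_edgesE)
      have cross: "{x, ?i y} \<in> S2" if xy: "x \<in> B" "y \<in> C" "card (sym_diff x (?i y)) = 1" for x y
      proof -
        have "x = y" using xy BP CP by (intro d2) auto
        then show ?thesis using xy unfolding S2_def by blast
      qed
      consider "x \<in> B" "y \<in> B" | v where "x \<in> B" "v \<in> C" "y = ?i v"
        | u where "u \<in> C" "x = ?i u" "y \<in> B" | u v where "u \<in> C" "x = ?i u" "v \<in> C" "y = ?i v"
      proof -
        have "x \<in> B \<or> x \<in> ?i ` C" "y \<in> B \<or> y \<in> ?i ` C" using EBC E(1) by auto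
        then show ?thesis using that by (elim disjE imageE) simp_all
      qed
      then show "E \<in> S0 \<union> (`) ?i ` S1 \<union> S2"
      proof cases
        case 1
        then have "E \<in> S0"
          using cube_edgesI[OF BP BP E(2)] unfolding E(1) S0_def by simp
        then show ?thesis by blast
      next
        case 2
        then have "E \<in> S2" using cross[of x v] E by simp
        then show ?thesis by blast
      next
        case 3
        then have "{y, ?i u} \<in> S2" using cross[of y u] E sd[of x y] by simp
        moreover have "E = {y, ?i u}" using E 3 by blast
        ultimately show ?thesis by blast
      next
        case 4
        have "card (sym_diff u v) = 1" using d1[OF CP[OF 4(1)] CP[OF 4(3)]] E(2) 4 by metis
        then have "{u, v} \<in> S1" using cube_edgesI[OF CP[OF 4(1)] CP[OF 4(3)]] 4 by (simp add: S1_def)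
        moreover have "E = ?i ` {u, v}" using E(1) 4 by simp
        ultimately show ?thesis by blast
      qed
    qed
    have in0: "E \<in> {E \<in> cube_edges (Suc n). E \<subseteq> B \<union> ?i ` C}" if "E \<in> S0" for E
    proof -
      have "E \<in> cube_edges n" and EB: "E \<subseteq> B" using that by (simp_all add: S0_def)
      then obtain x y where E: "E = {x, y}" "x \<in> ?P" "y \<in> ?P" "card (sym_diff x y) = 1"
        by (elim cube_edgesE)
      have "E \<in> cube_edges (Suc n)"
        unfolding E(1) by (rule cube_edgesI[OF PS(1)[OF E(2)] PS(1)[OF E(3)] E(4)])
      then show ?thesis using EB by auto
    qed
    have in1: "?i ` E \<in> {E \<in> cube_edges (Suc n). E \<subseteq> B \<union> ?i ` C}" if "E \<in> S1" for E
    proof -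
      have "E \<in> cube_edges n" and EC: "E \<subseteq> C" using that by (simp_all add: S1_def)
      then obtain x y where E: "E = {x, y}" "x \<in> ?P" "y \<in> ?P" "card (sym_diff x y) = 1"
        by (elim cube_edgesE)
      then have "card (sym_diff (?i x) (?i y)) = 1" using d1[OF E(2,3)] by metis
      then have "{?i x, ?i y} \<in> cube_edges (Suc n)" by (rule cube_edgesI[OF PS(2)[OF E(2)] PS(2)[OF E(3)]])
      then show ?thesis using EC by (auto simp: E(1))
    qed
    have in2: "{x, ?i x} \<in> {E \<in> cube_edges (Suc n). E \<subseteq> B \<union> ?i ` C}"
      if "x \<in> B \<inter> C" for x
    proof -
      have "x \<in> ?P" using that BP by blast
      then have "{x, ?i x} \<in> cube_edges (Suc n)" by (intro cube_edgesI PS d3)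
      then show ?thesis using that by auto
    qed
    show "S0 \<union> (`) ?i ` S1 \<union> S2 \<subseteq> {E \<in> cube_edges (Suc n). E \<subseteq> B \<union> ?i ` C}"
      unfolding S2_def by (intro Un_least image_subsetI subsetI) (erule in0, erule in1, erule in2)
  qed
  have sub: "S0 \<subseteq> Pow ?P" "S1 \<subseteq> Pow ?P"
    using assms by (auto simp: S0_def S1_def)
  have ne: "E \<noteq> {}" if "E \<in> S0 \<union> S1" for E
    using that by (auto simp: S0_def S1_def cube_edges_def)
  have fin: "finite S0" "finite S1" "finite S2"
    using sub finite_subset[of _ "Pow ?P"] finite_subfamily[OF assms(1)]
    by (auto simp: S2_def)
  have dis1: "S0 \<inter> (`) ?i ` S1 = {}"
  proof -
    have False if "E \<in> S1" "?i ` E \<in> S0" for E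
    proof -
      obtain x where "x \<in> E" using ne \<open>E \<in> S1\<close> by blast
      then have "?i x \<in> ?P" using that sub by blast
      then show False using ni by blast
    qed
    then show ?thesis by blast
  qed
  have dis2: "(S0 \<union> (`) ?i ` S1) \<inter> S2 = {}"
  proof -
    have notin: "{x, ?i x} \<notin> S0 \<union> (`) ?i ` S1" if x: "x \<in> B \<inter> C" for x
    proof
      assume "{x, ?i x} \<in> S0 \<union> (`) ?i ` S1"
      then show False
      proof
        assume "{x, ?i x} \<in> S0"
        then have "?i x \<in> ?P" using sub(1) by (meson PowD insertCI subsetD)
        then show False using ni by blast
      next
        assume "{x, ?i x} \<in> (`) ?i ` S1"
        then obtain E where "{x, ?i x} = ?i ` E" by blast
        then have "Suc n \<in> x" by blast
        then show False using ni[OF BP] x by blast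
      qed
    qed
    have "S2 \<subseteq> - (S0 \<union> (`) ?i ` S1)"
      unfolding S2_def by (intro image_subsetI ComplI) (rule notin[THEN notE])
    then show ?thesis by (simp only: disjoint_eq_subset_Compl Int_commute)
  qed
  have "inj_on ((`) ?i) S1"
    using inj_on_image_Pow[OF inj_on_insert_Suc[of n]] sub(2) by (rule inj_on_subset)
  then have c1: "card ((`) ?i ` S1) = card S1" by (rule card_image)
  have "inj_on (\<lambda>x. {x, ?i x}) (B \<inter> C)"
  proof (rule inj_onI)
    fix x y assume xy: "x \<in> B \<inter> C" "y \<in> B \<inter> C" "{x, ?i x} = {y, ?i y}"
    then have "Suc n \<notin> x" "Suc n \<notin> y" using ni assms by blast+
    then show "x = y" using xy(3) by (metis doubleton_eq_iff insertI1)
  qed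
  then have c2: "card S2 = card (B \<inter> C)" unfolding S2_def by (rule card_image)
  show ?thesis
    unfolding induced_edges_def eq
    using fin dis1 dis2 c1 c2 by (simp add: card_Un_disjoint S0_def S1_def)
qed

lemma induced_edges_0 [simp]: "induced_edges 0 A = 0"
proof -
  have "cube_edges 0 = {}" by (auto simp: cube_edges_def)
  then show ?thesis by (simp add: induced_edges_def)
qed

text \<open>The edge-isoperimetric inequality of the cube: the edges between the halves number at
  most the size of the smaller half, which is the gain that superadditivity provides.\<close>

lemma induced_edges_le:
  assumes "A \<subseteq> Pow {1..n}"
  shows "induced_edges n A \<le> binary_edge_count (card A)"
  using assms
proof (induction n arbitrary: A)
  case (Suc n)
  obtain B C where BC: "B \<subseteq> Pow {1..n}" "C \<subseteq> Pow {1..n}" "A = B \<union> insert (Suc n) ` C"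
    using Suc.prems by (rule split_family)
  have "card (B \<inter> C) \<le> min (card B) (card C)"
    using BC(1,2) finite_subfamily by (simp add: card_mono)
  then show ?case
    using Suc.IH[OF BC(1)] Suc.IH[OF BC(2)] binary_edge_count_superadd[of "card B" "card C"]
    unfolding BC(3) induced_edges_split[OF BC(1,2)] card_split_family[OF BC(1,2)] by linarith
qed simp

section \<open>Initial segments of the binary order and the values of \<open>F\<close>\<close>

lemma initial_segment_full: "initial_segment n (2 ^ n) = Pow {1..n}"
  using card_initial_segment[of "2 ^ n" n]
  by (intro card_subset_eq) (auto simp: initial_segment_def card_Pow)

text \<open>Sets without \<open>Suc n\<close> precede all sets with it, and the latter are ordered
  by their remaining elements. Only one inclusion is shown by counting predecessors; equal
  cardinality gives the other.\<close>

lemma initial_segment_pow2_add: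
  assumes "r \<le> 2 ^ n"
  shows "initial_segment (Suc n) (2 ^ n + r) = Pow {1..n} \<union> insert (Suc n) ` initial_segment n r"
    (is "?L = ?R")
proof -
  let ?P = "Pow {1..n}"
  have I: "initial_segment n r \<subseteq> ?P" by (auto simp: initial_segment_def)
  have less_insert: "binary_less (insert (Suc n) y) (insert (Suc n) x) \<longleftrightarrow> binary_less y x"
    if "x \<in> ?P" "y \<in> ?P" for x y
  proof -
    have "sym_diff (insert (Suc n) y) (insert (Suc n) x) = sym_diff y x"
      using Suc_notin_Pow[OF that(1)] Suc_notin_Pow[OF that(2)] by auto
    moreover have "insert (Suc n) y = insert (Suc n) x \<longleftrightarrow> y = x"
      using Suc_notin_Pow[OF that(1)] Suc_notin_Pow[OF that(2)] by (meson insert_ident)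
    moreover have "Max (sym_diff y x) \<noteq> Suc n" if "y \<noteq> x"
    proof -
      have "Max (sym_diff y x) \<in> sym_diff y x"
        using \<open>x \<in> ?P\<close> \<open>y \<in> ?P\<close> that finite_subset[of _ "{1..n}"] by (intro Max_in) auto
      then show ?thesis using \<open>x \<in> ?P\<close> \<open>y \<in> ?P\<close> by auto
    qed
    ultimately show ?thesis by (auto simp: binary_less_def)
  qed
  have "?R \<subseteq> ?L"
  proof
    fix z assume "z \<in> ?R"
    then consider (low) "z \<in> ?P" | (high) x where "x \<in> initial_segment n r" "z = insert (Suc n) x"
      by blast
    then show "z \<in> ?L"
    proof cases
      case low
      then have "z \<in> initial_segment (Suc n) (2 ^ n)"
        using initial_segment_mono_dim[of n "Suc n" "2 ^ n"] initial_segment_full by auto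
      then show ?thesis by (auto simp: initial_segment_def)
    next
      case high
      have x: "x \<in> ?P" "card {y \<in> ?P. binary_less y x} < r"
        using high by (simp_all add: initial_segment_def)
      have "{y \<in> Pow {1..Suc n}. binary_less y z}
          \<subseteq> ?P \<union> insert (Suc n) ` {y \<in> ?P. binary_less y x}"
      proof
        fix y assume y: "y \<in> {y \<in> Pow {1..Suc n}. binary_less y z}"
        \<comment> \<open>Splitting the singleton family gives the case distinction on whether
          \<open>y\<close> contains \<open>Suc n\<close>.\<close>
        then have "{y} \<subseteq> Pow {1..Suc n}" by simp
        then obtain B C where BC: "B \<subseteq> ?P" "C \<subseteq> ?P" and "{y} = B \<union> insert (Suc n) ` C"
          by (rule split_family)
        then have "y \<in> B \<or> y \<in> insert (Suc n) ` C" by (metis Un_iff singletonI)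
        then consider "y \<in> ?P" | u where "u \<in> ?P" "y = insert (Suc n) u"
          using BC by (metis imageE subsetD)
        then show "y \<in> ?P \<union> insert (Suc n) ` {y \<in> ?P. binary_less y x}"
          using y less_insert[OF x(1)] high(2) by cases auto
      qed
      then have "card {y \<in> Pow {1..Suc n}. binary_less y z}
          \<le> card (?P \<union> insert (Suc n) ` {y \<in> ?P. binary_less y x})"
        by (intro card_mono) auto
      also have "\<dots> = 2 ^ n + card {y \<in> ?P. binary_less y x}"
        by (subst card_split_family) (auto simp: card_Pow)
      also have "\<dots> < 2 ^ n + r" using x by simp
      finally show ?thesis using x high by (auto simp: initial_segment_def)
    qed
  qed
  moreover have "card ?R = card ?L"
    using assms I by (simp add: card_split_family card_initial_segment card_Pow)
  moreover have "finite ?L" by (simp add: initial_segment_def)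
  ultimately show ?thesis using card_subset_eq by metis
qed

text \<open>The segment is a full lower cube with an initial segment above it; each of the
  \<open>r\<close> upper vertices contributes one edge to its lower neighbour.\<close>

lemma F_pow2_add:
  assumes "r \<le> 2 ^ n"
  shows "F (2 ^ n + r) = F (2 ^ n) + F r + r"
proof -
  have I: "initial_segment n r \<subseteq> Pow {1..n}" by (auto simp: initial_segment_def)
  have "F (2 ^ n + r) = induced_edges (Suc n) (initial_segment (Suc n) (2 ^ n + r))"
    using assms by (intro F_eq_induced_edges) simp
  also have "\<dots> = induced_edges n (Pow {1..n}) + induced_edges n (initial_segment n r)
      + card (Pow {1..n} \<inter> initial_segment n r)"
    unfolding initial_segment_pow2_add[OF assms] by (rule induced_edges_split) (use I in auto)
  also have "Pow {1..n} \<inter> initial_segment n r = initial_segment n r" using I by blast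
  finally show ?thesis
    using assms F_eq_induced_edges[of "2 ^ n" n]
    by (simp add: initial_segment_full F_eq_induced_edges card_initial_segment)
qed

lemma F_eq_binary_edge_count: "F k = binary_edge_count k"
proof (induction k rule: less_induct)
  case (less k)
  show ?case
  proof (cases "k \<le> 1")
    case True
    then have "F k = 0" using F_eq_induced_edges[of k 0] by simp
    then show ?thesis using True by (cases k) auto
  next
    case False
    \<comment> \<open>This places \<open>k\<close> in the range
      \<open>2 ^ n < k \<le> 2 ^ Suc n\<close>. The strict lower bound makes the induction
      hypothesis available at \<open>2 ^ n\<close>, also when \<open>k\<close> is itself a power of
      two.\<close>
    define n where "n = (LEAST n. k \<le> 2 ^ Suc n)"
    have "k < 2 ^ k" by (rule less_exp)
    also have "\<dots> \<le> 2 ^ Suc k" by simp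
    finally have ex: "k \<le> 2 ^ Suc k" by (rule less_imp_le)
    have n: "k \<le> 2 ^ Suc n" unfolding n_def using ex by (rule LeastI)
    have "2 ^ n < k"
    proof (cases n)
      case (Suc j)
      then have "\<not> k \<le> 2 ^ Suc j" unfolding n_def by (intro not_less_Least) simp
      then show ?thesis using Suc by simp
    qed (use False in simp)
    then obtain r where r: "k = 2 ^ n + r" by (metis le_iff_add less_imp_le)
    have "r \<le> 2 ^ n" using n r by simp
    moreover have "r < k" using r by simp
    ultimately show ?thesis
      using less[OF \<open>2 ^ n < k\<close>] less[of r] F_pow2_add binary_edge_count_pow2_add r by simp
  qed
qed

section \<open>Antipodal families and crossing pairs\<close>

lemma inj_on_compl: "inj_on (\<lambda>x. S - x) (Pow S)"
  by (rule inj_onI) blast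

lemma card_compl_family:
  assumes "A \<subseteq> Pow {1..n}"
  shows "card (compl_family n A) = card A"
  unfolding compl_family_def by (rule card_image[OF inj_on_subset[OF inj_on_compl assms]])

lemma compl_family_Int:
  assumes "A \<subseteq> Pow {1..n}" "B \<subseteq> Pow {1..n}"
  shows "compl_family n (A \<inter> B) = compl_family n A \<inter> compl_family n B"
  unfolding compl_family_def by (rule inj_on_image_Int[OF inj_on_compl assms])

lemma compl_family_involution:
  assumes "A \<subseteq> Pow {1..n}"
  shows "compl_family n (compl_family n A) = A"
proof -
  have "{1..n} - ({1..n} - x) = x" if "x \<in> A" for x
    using assms that by blast
  then show ?thesis by (simp add: compl_family_def image_image)
qed

lemma compl_family_subset: "compl_family n A \<subseteq> Pow {1..n}"
  by (auto simp: compl_family_def)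

lemma card_eq_sum_of_bool:
  assumes "finite P" "A \<subseteq> P"
  shows "card A = (\<Sum>x\<in>P. of_bool (x \<in> A))"
  using assms by (simp add: of_bool_def sum.If_cases Int_absorb1)

text \<open>Complementation carries one intersection bijectively onto the other.\<close>

lemma card_Int_compl_commute:
  assumes "A \<subseteq> Pow {1..n}" "B \<subseteq> Pow {1..n}"
  shows "card (A \<inter> compl_family n B) = card (B \<inter> compl_family n A)"
proof -
  have "compl_family n (A \<inter> compl_family n B) = B \<inter> compl_family n A"
    using compl_family_Int[OF assms(1) compl_family_subset] compl_family_involution[OF assms(2)]
    by (simp add: Int_commute)
  then show ?thesis using card_compl_family[of "A \<inter> compl_family n B" n] assms(1)
    by (metis le_infI1)
qed

text \<open>If an antipodal pair meets \<open>A\<close> in \<open>i\<close> points and \<open>B\<close> in \<open>j\<close> points, it contributes \<open>2 i j\<close>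
  to the left and \<open>2 ([i = 2] + [j = 2] + j)\<close> to the right.\<close>

lemma cross_pairs_le:
  assumes "A \<subseteq> Pow {1..n}" "B \<subseteq> Pow {1..n}"
  shows "2 * (card (A \<inter> B) + card (A \<inter> compl_family n B))
    \<le> card (A \<inter> compl_family n A) + card (B \<inter> compl_family n B) + 2 * card B"
proof -
  let ?P = "Pow {1..n}" and ?c = "compl_family n"
  let ?o = "\<lambda>S x. of_bool (x \<in> S) :: nat"
  have cd: "card S = (\<Sum>x\<in>?P. ?o S x)" if "S \<subseteq> ?P" for S
    using that by (intro card_eq_sum_of_bool) auto
  have sub: "?c A \<subseteq> ?P" "?c B \<subseteq> ?P" by (rule compl_family_subset)+
  have AB: "card (?c A \<inter> ?c B) = card (A \<inter> B)"
    using compl_family_Int[OF assms] card_compl_family[of "A \<inter> B" n] assms by (simp add: le_infI1)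
  have "2 * (card (A \<inter> B) + card (A \<inter> ?c B))
      = card (A \<inter> B) + card (?c A \<inter> ?c B) + card (A \<inter> ?c B) + card (B \<inter> ?c A)"
    using AB card_Int_compl_commute[OF assms] by simp
  also have "\<dots> = (\<Sum>x\<in>?P. ?o (A \<inter> B) x + ?o (?c A \<inter> ?c B) x + ?o (A \<inter> ?c B) x + ?o (B \<inter> ?c A) x)"
    using assms sub by (subst (1 2 3 4) cd) (auto simp: sum.distrib)
  \<comment> \<open>Let \<open>a, a', b, b'\<close> be the 0/1 indicators of \<open>A\<close>,
    \<open>?c A\<close>, \<open>B\<close>, \<open>?c B\<close> at \<open>x\<close>. The claim is
    then \<open>(a + a') * (b + b') \<le> a * a' + b * b' + b + b'\<close>.\<close>
  also have "\<dots> \<le> (\<Sum>x\<in>?P. ?o (A \<inter> ?c A) x + ?o (B \<inter> ?c B) x + ?o B x + ?o (?c B) x)"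
    by (intro sum_mono) auto
  also have "\<dots> = card (A \<inter> ?c A) + card (B \<inter> ?c B) + card B + card (?c B)"
    using assms sub by (subst (1 2 3 4) cd) (auto simp: sum.distrib)
  finally show ?thesis using card_compl_family[OF assms(2)] by simp
qed

text \<open>Complementation flips the top coordinate, so antipodal pairs always join the two halves.
  Each is counted from both ends, which gives them the same factor 2 as the crossing edges.\<close>

lemma f_split:
  assumes "B \<subseteq> Pow {1..n}" "C \<subseteq> Pow {1..n}"
  shows "f (Suc n) (B \<union> insert (Suc n) ` C) = 2 * induced_edges n B + 2 * induced_edges n C
    + 2 * (card (B \<inter> C) + card (B \<inter> compl_family n C))"
proof -
  let ?i = "insert (Suc n)"
  have "compl_family (Suc n) B = ?i ` compl_family n B"
  proof -
    have "{1..Suc n} - x = ?i ({1..n} - x)" if "x \<in> B" for x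
      using that assms(1) Suc_notin_Pow[of x n] by (auto simp: atLeastAtMostSuc_conv)
    then show ?thesis unfolding compl_family_def image_image by (rule image_cong[OF refl])
  qed
  moreover have "compl_family (Suc n) (?i ` C) = compl_family n C"
  proof -
    have "{1..Suc n} - ?i x = {1..n} - x" for x
      by (auto simp: atLeastAtMostSuc_conv)
    then show ?thesis unfolding compl_family_def image_image by simp
  qed
  ultimately have compl: "compl_family (Suc n) (B \<union> ?i ` C) = ?i ` compl_family n B \<union> compl_family n C"
    by (simp add: compl_family_def image_Un)
  have disj: "B \<inter> ?i ` compl_family n B = {}" "?i ` C \<inter> compl_family n C = {}"
    using assms(1) compl_family_subset[of n C] Suc_notin_Pow by blast+
  have "?i ` C \<inter> ?i ` compl_family n B = ?i ` (C \<inter> compl_family n B)"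
    using inj_on_image_Int[OF inj_on_insert_Suc assms(2) compl_family_subset] by simp
  then have "(B \<union> ?i ` C) \<inter> compl_family (Suc n) (B \<union> ?i ` C)
      = (B \<inter> compl_family n C) \<union> ?i ` (C \<inter> compl_family n B)"
    unfolding compl by (simp add: Int_Un_distrib Int_Un_distrib2 disj Un_commute)
  then have "card ((B \<union> ?i ` C) \<inter> compl_family (Suc n) (B \<union> ?i ` C))
      = card (B \<inter> compl_family n C) + card (C \<inter> compl_family n B)"
    using card_split_family[of "B \<inter> compl_family n C" n "C \<inter> compl_family n B"] assms
    by (metis le_infI1)
  then show ?thesis
    using card_Int_compl_commute[OF assms] induced_edges_split[OF assms] by (simp add: f_def)
qed

section \<open>Induction on the dimension\<close>

text \<open>The truncated difference is zero up to half the cube. It is needed because a half of a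
  small family may fill more than half of its own cube; for the full cube the bound is
  attained.\<close>

lemma f_le:
  assumes "A \<subseteq> Pow {1..n}"
  shows "f n A \<le> 2 * binary_edge_count (card A) + (2 * card A - 2 ^ n)"
  using assms
proof (induction n arbitrary: A)
  case 0
  \<comment> \<open>In dimension 0 the single point is its own antipode, and the excess term 2 - 1
    accounts for it.\<close>
  then have "A = {} \<or> A = {{}}" by auto
  then show ?case by (auto simp: f_def compl_family_def)
next
  case (Suc n)
  obtain B C where BC: "B \<subseteq> Pow {1..n}" "C \<subseteq> Pow {1..n}" "A = B \<union> insert (Suc n) ` C"
    using Suc.prems by (rule split_family)
  let ?X = "card (B \<inter> C) + card (B \<inter> compl_family n C)"
  have fin: "finite B" "finite C" "finite (compl_family n C)"
    by (rule finite_subfamily[OF BC(1)] finite_subfamily[OF BC(2)]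
        finite_subfamily[OF compl_family_subset])+
  have le: "card S \<le> 2 ^ n" if "S \<subseteq> Pow {1..n}" for S
    using card_mono[OF _ that] by (simp add: card_Pow)
  define k where "k = min (card B) (card C)"
  have "card (B \<inter> C) \<le> k"
    unfolding k_def using fin by (simp add: card_mono)
  moreover have "card (B \<inter> compl_family n C) \<le> k"
    unfolding k_def using fin card_compl_family[OF BC(2)] by (metis card_mono inf_le1 inf_le2 min.bounded_iff)
  ultimately have X1: "?X \<le> 2 * k" by linarith
  \<comment> \<open>\<open>cross_pairs_le\<close> is asymmetric, so it is applied in both orders to
    reach the minimum \<open>k\<close>.\<close>
  have "2 * ?X \<le> card (B \<inter> compl_family n B) + card (C \<inter> compl_family n C) + 2 * card C"
    using BC by (intro cross_pairs_le)
  moreover have "2 * ?X \<le> card (B \<inter> compl_family n B) + card (C \<inter> compl_family n C) + 2 * card B"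
    using cross_pairs_le[OF BC(2,1)] card_Int_compl_commute[OF BC(1,2)] by (simp add: Int_commute)
  ultimately have X2: "2 * ?X \<le> card (B \<inter> compl_family n B) + card (C \<inter> compl_family n C)
      + 2 * k"
    by (simp add: k_def min_def)
  have fA: "f (Suc n) A = 2 * induced_edges n B + 2 * induced_edges n C + 2 * ?X"
    unfolding BC(3) by (rule f_split[OF BC(1,2)])
  have "f (Suc n) A \<le> 2 * binary_edge_count (card B + card C)
      + (2 * (card B + card C) - 2 ^ Suc n)"
  proof (rule folded_cube_recurrence)
    show "f (Suc n) A \<le> 2 * binary_edge_count (card B) + 2 * binary_edge_count (card C)
        + 4 * min (card B) (card C)"
      unfolding k_def[symmetric]
      using fA X1 induced_edges_le[OF BC(1)] induced_edges_le[OF BC(2)] by simp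
    \<comment> \<open>The antipodal counts from \<open>X2\<close> complete the edge terms of the
      halves to \<open>f n B\<close> and \<open>f n C\<close>.\<close>
    have "f (Suc n) A \<le> f n B + f n C + 2 * k"
      using X2 fA by (simp add: f_def[of n])
    then show "f (Suc n) A \<le> 2 * binary_edge_count (card B) + (2 * card B - 2 ^ n)
        + (2 * binary_edge_count (card C) + (2 * card C - 2 ^ n)) + 2 * min (card B) (card C)"
      unfolding k_def[symmetric] using Suc.IH[OF BC(1)] Suc.IH[OF BC(2)] by linarith
  qed (use le BC in auto)
  then show ?case using card_split_family[OF BC(1,2)] BC(3) by simp
qed

theorem theorem3:
  fixes n :: nat and A :: "nat set set"
  assumes "n > 0" and "A \<subseteq> Pow {1..n}" and "card A \<le> 2 ^ (n - 1)"
  shows "f n A \<le> 2 * F (card A)"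
proof -
  \<comment> \<open>With this, the bound on \<open>card A\<close> makes the truncated term of
    \<open>f_le\<close> vanish.\<close>
  have "(2::nat) ^ n = 2 * 2 ^ (n - 1)" using assms(1) by (simp add: power_eq_if)
  then show ?thesis
    using f_le[OF assms(2)] assms(3) by (simp add: F_eq_binary_edge_count)
qed

end
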